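(* Let $d\ge 2$ and $m\ge 2$ be integers. Let $\mathcal X=\{X_1,\dots,X_m\}$ be a set of pairwise distinct points in $\mathbb R^d$, let $\mathbf p=\{p_1,\dots,p_m\}$ be nonnegative integers, and let $n$ be a nonnegative integer with $\binom{n+d}{d}=\sum_{q=1}^m\binom{p_q+d}{d}$. If $$p_1+p_2+\dots+p_m+m\le nd,$$ then the Hermite interpolation of type total degree for $\mathbf p$ and $\mathcal X$ is singular.
   Context: $\Pi_n^d$ denotes the space of real polynomials in $d$ variables of total degree at most $n$. With $\mathcal X$, $\mathbf p$, $n$ as in the claim, the Hermite interpolation problem of type total degree $(\mathbf p,\mathcal X)$ is: find $f\in\Pi_n^d$ with $\frac{\partial^{|\alpha|}f}{\partial x_1^{\alpha_1}\cdots\partial x_d^{\alpha_d}}(X_q)=c_{q,\alpha}$ for all $1\le q\le m$ and all $\alpha\in\mathbb N_0^d$ with $0\le|\alpha|=\alpha_1+\dots+\alpha_d\le p_q$. The problem is regular if it has a unique solution for every choice of real values $c_{q,\alpha}$, and singular otherwise. *)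

theory Defs
  imports "HOL-Analysis.Analysis"
begin

text \<open>
  Vectors in d-dimensional real space are elements of \<open>real^'d\<close>, so that \<open>d = CARD('d)\<close>; a
  multi-index is a function \<open>'d \<Rightarrow> nat\<close>. Real polynomials are identified with the functions they
  induce, which loses nothing because the field is infinite.
\<close>

definition mi_size :: "('d::finite \<Rightarrow> nat) \<Rightarrow> nat" where
  "mi_size \<alpha> = (\<Sum>i\<in>UNIV. \<alpha> i)"

definition mi_power :: "real^'d \<Rightarrow> ('d \<Rightarrow> nat) \<Rightarrow> real" where
  "mi_power x \<alpha> = (\<Prod>i\<in>UNIV. (x $ i) ^ \<alpha> i)"

definition poly_space :: "nat \<Rightarrow> (real^'d \<Rightarrow> real) set" where
  "poly_space n = {f. \<exists>a. f = (\<lambda>x. \<Sum>\<alpha> | mi_size \<alpha> \<le> n. a \<alpha> * mi_power x \<alpha>)}"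

definition partial_deriv :: "'d \<Rightarrow> (real^'d \<Rightarrow> real) \<Rightarrow> (real^'d \<Rightarrow> real)" where
  "partial_deriv i f = (\<lambda>x. deriv (\<lambda>t. f (x + t *\<^sub>R axis i 1)) 0)"

text \<open>
  A finite type carries no canonical order of the coordinates, so an enumeration is chosen in which
  the partial derivatives are taken. The choice is immaterial for polynomials, by
  \<open>mixed_partial_along_poly\<close> below.
\<close>

definition coords :: "'d::finite list" where
  "coords = (SOME is. distinct is \<and> set is = UNIV)"

definition mixed_partial_along ::
  "'d list \<Rightarrow> ('d \<Rightarrow> nat) \<Rightarrow> (real^'d \<Rightarrow> real) \<Rightarrow> (real^'d \<Rightarrow> real)" where
  "mixed_partial_along is \<alpha> f = foldr (\<lambda>i. partial_deriv i ^^ \<alpha> i) is f"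

definition mixed_partial :: "('d \<Rightarrow> nat) \<Rightarrow> (real^'d \<Rightarrow> real) \<Rightarrow> (real^'d \<Rightarrow> real)" where
  "mixed_partial \<alpha> f = mixed_partial_along coords \<alpha> f"

definition hermite_solution ::
  "nat \<Rightarrow> nat \<Rightarrow> (nat \<Rightarrow> nat) \<Rightarrow> (nat \<Rightarrow> real^'d) \<Rightarrow> (nat \<Rightarrow> ('d \<Rightarrow> nat) \<Rightarrow> real) \<Rightarrow>
    (real^'d \<Rightarrow> real) \<Rightarrow> bool" where
  "hermite_solution n m p X c f \<longleftrightarrow>
     f \<in> poly_space n \<and>
     (\<forall>q\<in>{1..m}. \<forall>\<alpha>. mi_size \<alpha> \<le> p q \<longrightarrow> mixed_partial \<alpha> f (X q) = c q \<alpha>)"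

definition hermite_regular ::
  "nat \<Rightarrow> nat \<Rightarrow> (nat \<Rightarrow> nat) \<Rightarrow> (nat \<Rightarrow> real^'d) \<Rightarrow> bool" where
  "hermite_regular n m p X \<longleftrightarrow> (\<forall>c. \<exists>!f. hermite_solution n m p X c f)"

definition hermite_singular ::
  "nat \<Rightarrow> nat \<Rightarrow> (nat \<Rightarrow> nat) \<Rightarrow> (nat \<Rightarrow> real^'d) \<Rightarrow> bool" where
  "hermite_singular n m p X \<longleftrightarrow> \<not> hermite_regular n m p X"

lemma coords: "distinct (coords :: 'd::finite list)" "set (coords :: 'd list) = UNIV"
proof -
  have "\<exists>is :: 'd list. distinct is \<and> set is = UNIV"
    using finite_distinct_list[of "UNIV :: 'd set"] by auto
  then have "distinct (coords :: 'd list) \<and> set (coords :: 'd list) = UNIV"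
    unfolding coords_def by (rule someI_ex)
  then show "distinct (coords :: 'd list)" "set (coords :: 'd list) = UNIV" by auto
qed

lemma finite_mi_size_le: "finite {\<alpha> :: 'd::finite \<Rightarrow> nat. mi_size \<alpha> \<le> n}"
proof (rule finite_subset)
  show "{\<alpha> :: 'd \<Rightarrow> nat. mi_size \<alpha> \<le> n} \<subseteq> Pi\<^sub>E UNIV (\<lambda>_. {..n})"
  proof (intro subsetI PiE_I)
    fix \<alpha> :: "'d \<Rightarrow> nat" and i
    assume "\<alpha> \<in> {\<alpha>. mi_size \<alpha> \<le> n}"
    moreover have "\<alpha> i \<le> mi_size \<alpha>" unfolding mi_size_def by (rule member_le_sum) auto
    ultimately show "\<alpha> i \<in> {..n}" by simp
  qed auto
  show "finite (Pi\<^sub>E (UNIV :: 'd set) (\<lambda>_. {..n}))" by (intro finite_PiE) auto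
qed

text \<open>The k-th derivative of \<open>t ^ b\<close>; for \<open>k > b\<close> the falling factorial vanishes.\<close>

definition power_deriv :: "nat \<Rightarrow> nat \<Rightarrow> real \<Rightarrow> real" where
  "power_deriv b k t = (\<Prod>j<k. real b - real j) * t ^ (b - k)"

lemma has_real_derivative_power_deriv:
  "(power_deriv b k has_real_derivative power_deriv b (Suc k) t) (at t)"
proof (cases "b > k")
  case True
  then show ?thesis unfolding power_deriv_def
    by (auto intro!: derivative_eq_intros simp: of_nat_diff)
next
  case False
  then have "power_deriv b (Suc k) t = 0" unfolding power_deriv_def
    by (cases "b = k") auto
  moreover have "power_deriv b k = (\<lambda>_. \<Prod>j<k. real b - real j)"
    using False unfolding power_deriv_def by auto
  ultimately show ?thesis by simp
qed

lemma partial_deriv_poly: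
  fixes a :: "('d::finite \<Rightarrow> nat) \<Rightarrow> real"
  shows "partial_deriv i (\<lambda>x. \<Sum>\<beta>\<in>S. a \<beta> * (\<Prod>k\<in>UNIV. power_deriv (\<beta> k) (\<gamma> k) (x $ k))) =
         (\<lambda>x. \<Sum>\<beta>\<in>S. a \<beta> * (\<Prod>k\<in>UNIV. power_deriv (\<beta> k) ((\<gamma>(i := Suc (\<gamma> i))) k) (x $ k)))"
proof
  fix x :: "real^'d"
  have split: "(\<Prod>k\<in>UNIV. g k) = g i * (\<Prod>k\<in>UNIV-{i}. g k)" for g :: "'d \<Rightarrow> real"
    by (rule prod.remove) auto
  have "((\<lambda>t. power_deriv (\<beta> i) (\<gamma> i) (x $ i + t)) has_real_derivative
          power_deriv (\<beta> i) (Suc (\<gamma> i)) (x $ i)) (at 0)" for \<beta> :: "'d \<Rightarrow> nat"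
    using has_real_derivative_power_deriv[of "\<beta> i" "\<gamma> i" "x $ i"]
    using DERIV_shift[of "power_deriv (\<beta> i) (\<gamma> i)" _ 0 "x $ i"] by (simp add: add.commute)
  then have "((\<lambda>t. \<Sum>\<beta>\<in>S. a \<beta> * (power_deriv (\<beta> i) (\<gamma> i) (x $ i + t) *
               (\<Prod>k\<in>UNIV-{i}. power_deriv (\<beta> k) (\<gamma> k) (x $ k)))) has_real_derivative
        (\<Sum>\<beta>\<in>S. a \<beta> * (power_deriv (\<beta> i) (Suc (\<gamma> i)) (x $ i) *
               (\<Prod>k\<in>UNIV-{i}. power_deriv (\<beta> k) (\<gamma> k) (x $ k))))) (at 0)"
    by (intro DERIV_sum DERIV_cmult DERIV_cmult_right)
  moreover have "(\<Prod>k\<in>UNIV-{i}. power_deriv (\<beta> k) (\<gamma> k) ((x + t *\<^sub>R axis i 1) $ k)) =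
      (\<Prod>k\<in>UNIV-{i}. power_deriv (\<beta> k) (\<gamma> k) (x $ k))" for \<beta> t
    by (rule prod.cong) (auto simp: axis_def)
  moreover have "(\<Prod>k\<in>UNIV-{i}. power_deriv (\<beta> k) ((\<gamma>(i := Suc (\<gamma> i))) k) (x $ k)) =
      (\<Prod>k\<in>UNIV-{i}. power_deriv (\<beta> k) (\<gamma> k) (x $ k))" for \<beta>
    by (rule prod.cong) auto
  moreover have "(x + t *\<^sub>R axis i 1) $ i = x $ i + t" for t
    by (simp add: axis_def)
  ultimately show "partial_deriv i
      (\<lambda>x. \<Sum>\<beta>\<in>S. a \<beta> * (\<Prod>k\<in>UNIV. power_deriv (\<beta> k) (\<gamma> k) (x $ k))) x =
    (\<Sum>\<beta>\<in>S. a \<beta> * (\<Prod>k\<in>UNIV. power_deriv (\<beta> k) ((\<gamma>(i := Suc (\<gamma> i))) k) (x $ k)))"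
    unfolding partial_deriv_def split by (intro DERIV_imp_deriv) (simp only: fun_upd_same)
qed

lemma partial_deriv_funpow_poly:
  fixes a :: "('d::finite \<Rightarrow> nat) \<Rightarrow> real"
  shows "(partial_deriv i ^^ r) (\<lambda>x. \<Sum>\<beta>\<in>S. a \<beta> * (\<Prod>k\<in>UNIV. power_deriv (\<beta> k) (\<gamma> k) (x $ k))) =
         (\<lambda>x. \<Sum>\<beta>\<in>S. a \<beta> * (\<Prod>k\<in>UNIV. power_deriv (\<beta> k) ((\<gamma>(i := \<gamma> i + r)) k) (x $ k)))"
  by (induction r) (simp_all only: funpow.simps o_def id_def partial_deriv_poly, simp_all)

lemma foldr_partial_deriv_poly:
  fixes a :: "('d::finite \<Rightarrow> nat) \<Rightarrow> real"
  assumes "distinct is"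
  shows "foldr (\<lambda>i. partial_deriv i ^^ \<alpha> i) is
           (\<lambda>x. \<Sum>\<beta>\<in>S. a \<beta> * (\<Prod>k\<in>UNIV. (x $ k) ^ \<beta> k)) =
         (\<lambda>x. \<Sum>\<beta>\<in>S. a \<beta> *
           (\<Prod>k\<in>UNIV. power_deriv (\<beta> k) ((\<lambda>k. if k \<in> set is then \<alpha> k else 0) k) (x $ k)))"
  using assms
proof (induction "is")
  case Nil
  then show ?case by (simp add: power_deriv_def)
next
  case (Cons i "is")
  have "(\<lambda>k. if k \<in> set is then \<alpha> k else 0)
          (i := (if i \<in> set is then \<alpha> i else 0) + \<alpha> i) =
        (\<lambda>k. if k \<in> set (i # is) then \<alpha> k else 0)"
    using Cons.prems by auto
  with Cons show ?case by (simp only: foldr.simps o_def distinct.simps partial_deriv_funpow_poly)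
qed

lemma mixed_partial_along_poly:
  fixes a :: "('d::finite \<Rightarrow> nat) \<Rightarrow> real"
  assumes "distinct is" "set is = UNIV"
  shows "mixed_partial_along is \<alpha> (\<lambda>x. \<Sum>\<beta>\<in>S. a \<beta> * mi_power x \<beta>) =
         (\<lambda>x. \<Sum>\<beta>\<in>S. a \<beta> *
           (\<Prod>k\<in>UNIV. (\<Prod>j<\<alpha> k. real (\<beta> k) - real j) * (x $ k) ^ (\<beta> k - \<alpha> k)))"
  unfolding mixed_partial_along_def mi_power_def foldr_partial_deriv_poly[OF assms(1)]
  by (simp add: assms(2) power_deriv_def)

end

theory Submission
  imports Defs
begin

text \<open>
  The Hermite problem with zero data always has the solution \<open>0\<close>, so it suffices to find a second
  one: a nonzero polynomial of degree at most \<open>n\<close> that vanishes to order \<open>p q + 1\<close> at every \<open>X q\<close>.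
  Such a polynomial is a product of \<open>n\<close> affine functions. Through any \<open>d\<close> points of \<open>d\<close>-dimensional
  space there passes a hyperplane, so \<open>n\<close> hyperplanes offer \<open>n * d\<close> incidences with points, whereas
  placing each \<open>X q\<close> on \<open>p q + 1\<close> of them costs \<open>p\<^sub>1 + \<dots> + p\<^sub>m + m \<le> n * d\<close>.

  The incidences can be distributed if no point asks for more than \<open>n\<close> hyperplanes. This follows
  from the dimension count: as \<open>m \<ge> 2\<close>, each binomial coefficient on the right is smaller than the
  one on the left, hence \<open>p q < n\<close>. Then dealing out the incidences cyclically to the hyperplanes,
  all those of one point in succession, never gives a hyperplane the same point twice
  (\<open>round_robin_distribution\<close>). The product of the affine functions vanishes at \<open>X q\<close> to the
  required order by the Leibniz rule (\<open>vanishing_order_mult\<close>), and it is nonzero because finitely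
  many hyperplanes do not cover the space (\<open>prod_affine_nonzero\<close>).
\<close>

section \<open>Closure properties of the spaces of polynomials\<close>

lemma poly_space_monomial_sumI:
  fixes g :: "'b \<Rightarrow> ('d::finite \<Rightarrow> nat)"
  assumes "finite B" and "\<And>\<beta>. \<beta> \<in> B \<Longrightarrow> mi_size (g \<beta>) \<le> n"
  shows "(\<lambda>x. \<Sum>\<beta>\<in>B. b \<beta> * mi_power x (g \<beta>)) \<in> poly_space n"
proof -
  have "(\<Sum>\<beta>\<in>B. b \<beta> * mi_power x (g \<beta>)) =
      (\<Sum>\<alpha> | mi_size \<alpha> \<le> n. (\<Sum>\<beta> | \<beta> \<in> B \<and> g \<beta> = \<alpha>. b \<beta>) * mi_power x \<alpha>)" for x
  proof -
    have "(\<Sum>\<beta>\<in>B. b \<beta> * mi_power x (g \<beta>)) =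
        (\<Sum>\<alpha> | mi_size \<alpha> \<le> n. \<Sum>\<beta> | \<beta> \<in> B \<and> g \<beta> = \<alpha>. b \<beta> * mi_power x (g \<beta>))"
      using assms by (intro sum.group[symmetric] finite_mi_size_le) auto
    then show ?thesis by (simp add: sum_distrib_right)
  qed
  then show ?thesis
    unfolding poly_space_def
    by (intro CollectI exI[of _ "\<lambda>\<alpha>. \<Sum>\<beta> | \<beta> \<in> B \<and> g \<beta> = \<alpha>. b \<beta>"]) auto
qed

lemma poly_space_zero: "(\<lambda>x. 0) \<in> poly_space n"
  using poly_space_monomial_sumI[of "{}"] by simp

lemma poly_space_one: "(\<lambda>x. 1) \<in> poly_space 0"
  using poly_space_monomial_sumI[of "{\<lambda>_. 0}" "\<lambda>\<beta>. \<beta>" 0 "\<lambda>_. 1"]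
  by (simp add: mi_size_def mi_power_def)

lemma poly_space_add:
  assumes "f \<in> poly_space n" and "g \<in> poly_space n"
  shows "(\<lambda>x. f x + g x) \<in> poly_space n"
proof -
  obtain a b where "f = (\<lambda>x. \<Sum>\<alpha> | mi_size \<alpha> \<le> n. a \<alpha> * mi_power x \<alpha>)"
    and "g = (\<lambda>x. \<Sum>\<alpha> | mi_size \<alpha> \<le> n. b \<alpha> * mi_power x \<alpha>)"
    using assms unfolding poly_space_def by auto
  then show ?thesis
    unfolding poly_space_def
    by (intro CollectI exI[of _ "\<lambda>\<alpha>. a \<alpha> + b \<alpha>"]) (simp add: sum.distrib distrib_right)
qed

lemma poly_space_scale:
  assumes "f \<in> poly_space n"
  shows "(\<lambda>x. c * f x) \<in> poly_space n"
proof -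
  obtain a where "f = (\<lambda>x. \<Sum>\<alpha> | mi_size \<alpha> \<le> n. a \<alpha> * mi_power x \<alpha>)"
    using assms unfolding poly_space_def by auto
  then show ?thesis
    unfolding poly_space_def
    by (intro CollectI exI[of _ "\<lambda>\<alpha>. c * a \<alpha>"]) (simp add: sum_distrib_left mult.assoc)
qed

lemma poly_space_sum:
  assumes "finite I" and "\<And>i. i \<in> I \<Longrightarrow> f i \<in> poly_space n"
  shows "(\<lambda>x. \<Sum>i\<in>I. f i x) \<in> poly_space n"
  using assms by (induction I rule: finite_induct) (auto intro: poly_space_zero poly_space_add)

lemma poly_space_Suc:
  assumes "f \<in> poly_space n"
  shows "f \<in> poly_space (Suc n)"
proof -
  obtain a where "f = (\<lambda>x. \<Sum>\<alpha> | mi_size \<alpha> \<le> n. a \<alpha> * mi_power x \<alpha>)"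
    using assms unfolding poly_space_def by auto
  then show ?thesis
    using poly_space_monomial_sumI[OF finite_mi_size_le[of n], of "\<lambda>\<alpha>. \<alpha>" "Suc n" a] by simp
qed

lemma mi_size_increment: "mi_size (\<alpha>(i := Suc (\<alpha> i))) = Suc (mi_size \<alpha>)"
proof -
  have "(\<Sum>k\<in>UNIV - {i}. (\<alpha>(i := Suc (\<alpha> i))) k) = (\<Sum>k\<in>UNIV - {i}. \<alpha> k)"
    by (rule sum.cong) auto
  then show ?thesis
    unfolding mi_size_def by (simp add: sum.remove[of UNIV i])
qed

lemma mi_power_increment: "mi_power x (\<alpha>(i := Suc (\<alpha> i))) = x $ i * mi_power x \<alpha>"
proof -
  have "(\<Prod>k\<in>UNIV - {i}. (x $ k) ^ (\<alpha>(i := Suc (\<alpha> i))) k) = (\<Prod>k\<in>UNIV - {i}. (x $ k) ^ \<alpha> k)"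
    by (rule prod.cong) auto
  then show ?thesis
    unfolding mi_power_def by (simp add: prod.remove[of UNIV i])
qed

lemma poly_space_coordinate_mult:
  assumes "f \<in> poly_space n"
  shows "(\<lambda>x. x $ i * f x) \<in> poly_space (Suc n)"
proof -
  obtain a where "f = (\<lambda>x. \<Sum>\<alpha> | mi_size \<alpha> \<le> n. a \<alpha> * mi_power x \<alpha>)"
    using assms unfolding poly_space_def by auto
  then have "(\<lambda>x. x $ i * f x) =
      (\<lambda>x. \<Sum>\<alpha> | mi_size \<alpha> \<le> n. a \<alpha> * mi_power x (\<alpha>(i := Suc (\<alpha> i))))"
    by (simp only: mi_power_increment) (simp add: sum_distrib_left mult_ac)
  then show ?thesis
    by (simp only:)
      (rule poly_space_monomial_sumI[OF finite_mi_size_le], simp only: mi_size_increment, simp)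
qed

lemma poly_space_affine_mult:
  fixes v :: "real^'d"
  assumes "f \<in> poly_space n"
  shows "(\<lambda>x. (v \<bullet> x - c) * f x) \<in> poly_space (Suc n)"
proof -
  have "(\<lambda>x. (v \<bullet> x - c) * f x) = (\<lambda>x. (\<Sum>i\<in>UNIV. v $ i * (x $ i * f x)) + (- c) * f x)"
    by (simp add: inner_vec_def left_diff_distrib sum_distrib_right mult.assoc)
  moreover have "(\<lambda>x. (\<Sum>i\<in>UNIV. v $ i * (x $ i * f x)) + (- c) * f x) \<in> poly_space (Suc n)"
    using assms
    by (intro poly_space_add poly_space_sum poly_space_scale poly_space_coordinate_mult
        poly_space_Suc) auto
  ultimately show ?thesis by (simp only:)
qed

lemma prod_affine_in_poly_space:
  fixes v :: "nat \<Rightarrow> real^'d"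
  shows "(\<lambda>x. \<Prod>j<n. v j \<bullet> x - b j) \<in> poly_space n"
proof (induction n)
  case 0
  then show ?case by (simp add: poly_space_one)
next
  case (Suc n)
  then show ?case using poly_space_affine_mult[OF Suc, of "v n" "b n"] by (simp add: mult.commute)
qed

lemma prod_affine_nonzero:
  fixes v :: "'b \<Rightarrow> 'a::euclidean_space"
  assumes "finite J" and "\<And>j. j \<in> J \<Longrightarrow> v j \<noteq> 0"
  shows "\<exists>x. (\<Prod>j\<in>J. v j \<bullet> x - b j) \<noteq> 0"
proof -
  have "negligible (\<Union>j\<in>J. {x. v j \<bullet> x = b j})"
    using assms by (intro negligible_Union) (auto simp: negligible_hyperplane)
  then have "(\<Union>j\<in>J. {x. v j \<bullet> x = b j}) \<noteq> UNIV"
    using non_negligible_UNIV by metis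
  then show ?thesis using assms(1) by auto
qed

section \<open>Order of vanishing at a point\<close>

text \<open>
  The derivative rules need differentiability along the axes, and repeated use of them needs a class
  of functions that is closed under partial derivatives. \<open>real_polynomial_function\<close> is one, and its
  induction rule yields both at once.
\<close>

lemma real_polynomial_function_partial_deriv_exists:
  fixes f :: "real^'d \<Rightarrow> real"
  assumes "real_polynomial_function f"
  shows "\<exists>f'. real_polynomial_function f' \<and>
    (\<forall>x. ((\<lambda>t. f (x + t *\<^sub>R axis i 1)) has_real_derivative f' x) (at 0))"
  using assms
proof (induction rule: real_polynomial_function.induct)
  case (linear f)
  then interpret bounded_linear f .
  have "((\<lambda>t. f (x + t *\<^sub>R axis i 1)) has_real_derivative f (axis i 1)) (at 0)" for x
    unfolding add scaleR by (auto intro!: derivative_eq_intros)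
  then show ?case by (intro exI[of _ "\<lambda>x. f (axis i 1)"]) auto
next
  case (const c)
  then show ?case by (intro exI[of _ "\<lambda>x. 0"]) auto
next
  case (add f g)
  then obtain f' g' where "real_polynomial_function f'" "real_polynomial_function g'"
    "\<And>x. ((\<lambda>t. f (x + t *\<^sub>R axis i 1)) has_real_derivative f' x) (at 0)"
    "\<And>x. ((\<lambda>t. g (x + t *\<^sub>R axis i 1)) has_real_derivative g' x) (at 0)"
    by blast
  then show ?case
    by (intro exI[of _ "\<lambda>x. f' x + g' x"] conjI allI DERIV_add
        real_polynomial_function.intros(3))
next
  case (mult f g)
  then obtain f' g' where "real_polynomial_function f'" "real_polynomial_function g'"
    and D: "\<And>x. ((\<lambda>t. f (x + t *\<^sub>R axis i 1)) has_real_derivative f' x) (at 0)"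
      "\<And>x. ((\<lambda>t. g (x + t *\<^sub>R axis i 1)) has_real_derivative g' x) (at 0)"
    by blast
  have "((\<lambda>t. f (x + t *\<^sub>R axis i 1) * g (x + t *\<^sub>R axis i 1)) has_real_derivative
      f' x * g x + g' x * f x) (at 0)" for x
    using DERIV_mult[OF D[of x]] by simp
  with mult.hyps \<open>real_polynomial_function f'\<close> \<open>real_polynomial_function g'\<close> show ?case
    by (intro exI[of _ "\<lambda>x. f' x * g x + g' x * f x"] conjI allI
        real_polynomial_function.intros(3,4))
      auto
qed

lemma
  fixes f :: "real^'d \<Rightarrow> real"
  assumes "real_polynomial_function f"
  shows real_polynomial_function_partial_deriv: "real_polynomial_function (partial_deriv i f)"
    and has_real_derivative_partial_deriv:
      "((\<lambda>t. f (x + t *\<^sub>R axis i 1)) has_real_derivative partial_deriv i f x) (at 0)"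
proof -
  obtain f' where f': "real_polynomial_function f'"
    "\<And>x. ((\<lambda>t. f (x + t *\<^sub>R axis i 1)) has_real_derivative f' x) (at 0)"
    using real_polynomial_function_partial_deriv_exists[OF assms, of i] by blast
  have "partial_deriv i f x = f' x" for x
    unfolding partial_deriv_def using f'(2) by (rule DERIV_imp_deriv)
  then have "partial_deriv i f = f'" ..
  with f' show "real_polynomial_function (partial_deriv i f)"
    "((\<lambda>t. f (x + t *\<^sub>R axis i 1)) has_real_derivative partial_deriv i f x) (at 0)"
    by auto
qed

lemma partial_deriv_add:
  fixes f g :: "real^'d \<Rightarrow> real"
  assumes "real_polynomial_function f" and "real_polynomial_function g"
  shows "partial_deriv i (\<lambda>x. f x + g x) = (\<lambda>x. partial_deriv i f x + partial_deriv i g x)"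
proof
  fix x
  show "partial_deriv i (\<lambda>x. f x + g x) x = partial_deriv i f x + partial_deriv i g x"
    using DERIV_add[OF assms[THEN has_real_derivative_partial_deriv[where i=i and x=x]]]
    by (subst partial_deriv_def) (rule DERIV_imp_deriv)
qed

lemma partial_deriv_mult:
  fixes f g :: "real^'d \<Rightarrow> real"
  assumes "real_polynomial_function f" and "real_polynomial_function g"
  shows "partial_deriv i (\<lambda>x. f x * g x) =
    (\<lambda>x. partial_deriv i f x * g x + f x * partial_deriv i g x)"
proof
  fix x
  show "partial_deriv i (\<lambda>x. f x * g x) x = partial_deriv i f x * g x + f x * partial_deriv i g x"
    using DERIV_mult[OF assms[THEN has_real_derivative_partial_deriv[where i=i and x=x]]]
    by (subst partial_deriv_def) (simp add: DERIV_imp_deriv mult.commute)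
qed

text \<open>
  All iterated partial derivatives of order less than \<open>k\<close>, taken in any sequence of directions,
  vanish at \<open>x\<close>. Quantifying over all sequences of directions makes the Leibniz rule a plain
  induction, with no commutation of derivatives.
\<close>

primrec vanishing_order :: "nat \<Rightarrow> real^'d \<Rightarrow> (real^'d \<Rightarrow> real) \<Rightarrow> bool" where
  "vanishing_order 0 x f \<longleftrightarrow> True"
| "vanishing_order (Suc k) x f \<longleftrightarrow> f x = 0 \<and> (\<forall>i. vanishing_order k x (partial_deriv i f))"

lemma vanishing_order_antimono:
  "vanishing_order l x f \<Longrightarrow> k \<le> l \<Longrightarrow> vanishing_order k x f"
proof (induction k arbitrary: f l)
  case (Suc k)
  then obtain l' where "l = Suc l'" "k \<le> l'" by (cases l) auto
  with Suc show ?case by auto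
qed simp

lemma vanishing_order_add:
  assumes "real_polynomial_function f" and "real_polynomial_function g"
    and "vanishing_order k x f" and "vanishing_order k x g"
  shows "vanishing_order k x (\<lambda>y. f y + g y)"
  using assms
  by (induction k arbitrary: f g)
    (auto simp: partial_deriv_add intro: real_polynomial_function_partial_deriv)

text \<open>
  Each term of the Leibniz rule differentiates only one factor, so the total order drops by one. If
  the factor differentiated has order \<open>0\<close>, then the order of the term does not drop at all.
\<close>

lemma vanishing_order_mult:
  assumes "real_polynomial_function f" and "real_polynomial_function g"
    and "vanishing_order k x f" and "vanishing_order l x g"
  shows "vanishing_order (k + l) x (\<lambda>y. f y * g y)"
  using assms
proof (induction "k + l" arbitrary: k l f g)
  case 0
  then show ?case by simp
next
  case (Suc r)
  have "vanishing_order r x (\<lambda>y. partial_deriv i f y * g y)" for i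
  proof (cases k)
    case 0
    then obtain l' where "l = Suc l'" "r = 0 + l'" using Suc.hyps(2) by auto
    then show ?thesis
      using Suc.hyps(1)[of 0 l' "partial_deriv i f" g] Suc.prems
        vanishing_order_antimono[of l x g l']
      by (simp add: real_polynomial_function_partial_deriv)
  next
    case (Suc k')
    then show ?thesis
      using Suc.hyps(1)[of k' l "partial_deriv i f" g] \<open>Suc r = k + l\<close> Suc.prems
      by (simp add: real_polynomial_function_partial_deriv)
  qed
  moreover have "vanishing_order r x (\<lambda>y. f y * partial_deriv i g y)" for i
  proof (cases l)
    case 0
    then obtain k' where "k = Suc k'" "r = k' + 0" using Suc.hyps(2) by auto
    then show ?thesis
      using Suc.hyps(1)[of k' 0 f "partial_deriv i g"] Suc.prems
        vanishing_order_antimono[of k x f k']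
      by (simp add: real_polynomial_function_partial_deriv)
  next
    case (Suc l')
    then show ?thesis
      using Suc.hyps(1)[of k l' f "partial_deriv i g"] \<open>Suc r = k + l\<close> Suc.prems
      by (simp add: real_polynomial_function_partial_deriv)
  qed
  ultimately have "vanishing_order r x (partial_deriv i (\<lambda>y. f y * g y))" for i
    unfolding partial_deriv_mult[OF Suc.prems(1,2)] using Suc.prems(1,2)
    by (intro vanishing_order_add real_polynomial_function.intros(4)
        real_polynomial_function_partial_deriv)
  moreover have "f x * g x = 0"
    using Suc.hyps(2) Suc.prems(3,4) by (cases k; cases l) auto
  ultimately show ?case unfolding \<open>Suc r = k + l\<close>[symmetric] by simp
qed

lemma vanishing_order_prod:
  assumes "finite J" and "\<And>j. j \<in> J \<Longrightarrow> real_polynomial_function (f j)"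
  shows "vanishing_order (card {j \<in> J. f j x = 0}) x (\<lambda>y. \<Prod>j\<in>J. f j y)"
  using assms
proof (induction J rule: finite_induct)
  case (insert j J)
  have "real_polynomial_function (\<lambda>y. \<Prod>j\<in>J. f j y)"
    using insert.hyps(1) insert.prems by (intro real_polynomial_function_prod) auto
  moreover have "vanishing_order (if f j x = 0 then 1 else 0) x (f j)" by simp
  moreover have "{i \<in> insert j J. f i x = 0} =
      (if f j x = 0 then insert j {i \<in> J. f i x = 0} else {i \<in> J. f i x = 0})"
    by auto
  ultimately show ?case
    using insert vanishing_order_mult[of "f j" "\<lambda>y. \<Prod>j\<in>J. f j y"
        "if f j x = 0 then 1 else 0" x "card {j \<in> J. f j x = 0}"]
    by (auto split: if_splits)
qed simp

lemma vanishing_order_partial_deriv_funpow: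
  "vanishing_order (k + r) x f \<Longrightarrow> vanishing_order k x ((partial_deriv i ^^ r) f)"
  by (induction r arbitrary: f) (simp_all del: funpow.simps add: funpow_Suc_right)

lemma vanishing_order_mixed_partial_along:
  "vanishing_order (k + sum_list (map \<alpha> is)) x f \<Longrightarrow>
    vanishing_order k x (mixed_partial_along is \<alpha> f)"
  unfolding mixed_partial_along_def
  by (induction "is" arbitrary: k)
    (auto intro!: vanishing_order_partial_deriv_funpow simp: add.assoc)

lemma mixed_partial_eq_0:
  assumes "vanishing_order k x f" and "mi_size \<alpha> < k"
  shows "mixed_partial \<alpha> f x = 0"
proof -
  have "sum_list (map \<alpha> coords) = mi_size \<alpha>"
    unfolding mi_size_def using coords by (metis sum_list_distinct_conv_sum_set)
  then have "vanishing_order (Suc 0 + sum_list (map \<alpha> coords)) x f"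
    using assms by (intro vanishing_order_antimono[OF assms(1)]) simp
  then have "vanishing_order (Suc 0) x (mixed_partial \<alpha> f)"
    unfolding mixed_partial_def by (rule vanishing_order_mixed_partial_along)
  then show ?thesis by simp
qed

lemma vanishing_order_zero:
  fixes x :: "real^'d"
  shows "vanishing_order k x (\<lambda>y. 0)"
proof (induction k)
  case (Suc k)
  have "partial_deriv i (\<lambda>y. 0) = (\<lambda>y. 0)" for i :: 'd
    unfolding partial_deriv_def by (simp only: deriv_const)
  with Suc show ?case by (simp only: vanishing_order.simps simp_thms)
qed simp

section \<open>Distributing the points over the hyperplanes\<close>

lemma consecutive_blocks:
  fixes w :: "'a \<Rightarrow> nat"
  assumes "finite Q"
  shows "\<exists>u. \<forall>q\<in>Q. \<exists>s. s + w q \<le> sum w Q \<and> (\<forall>k\<in>{s..<s + w q}. u k = q)"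
  using assms
proof (induction Q rule: finite_induct)
  case (insert r Q)
  obtain u where u: "\<And>q. q \<in> Q \<Longrightarrow>
      \<exists>s. s + w q \<le> sum w Q \<and> (\<forall>k\<in>{s..<s + w q}. u k = q)"
    using insert.IH by metis
  let ?u = "\<lambda>k. if k < sum w Q then u k else r"
  have "\<exists>s. s + w q \<le> sum w (insert r Q) \<and> (\<forall>k\<in>{s..<s + w q}. ?u k = q)"
    if q: "q \<in> insert r Q" for q
  proof (cases "q = r")
    case True
    then show ?thesis using insert.hyps by (intro exI[of _ "sum w Q"]) auto
  next
    case False
    then obtain s where "s + w q \<le> sum w Q" "\<forall>k\<in>{s..<s + w q}. u k = q"
      using u[of q] q by blast
    then show ?thesis using insert.hyps by (intro exI[of _ s]) auto
  qed
  then show ?case by (intro exI[of _ ?u] ballI)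
qed simp

text \<open>
  Lay out \<open>w q\<close> copies of each \<open>q\<close> as consecutive blocks of \<open>{..<n * d}\<close> and let class \<open>j\<close> receive
  the positions congruent to \<open>j\<close> modulo \<open>n\<close>. There are \<open>d\<close> such positions, and a block of length at
  most \<open>n\<close> meets as many residue classes as it has positions.
\<close>

lemma round_robin_distribution:
  fixes w :: "'a \<Rightarrow> nat"
  assumes "finite Q" and "\<And>q. q \<in> Q \<Longrightarrow> w q \<le> n" and "sum w Q \<le> n * d"
  shows "\<exists>A. (\<forall>j. finite (A j) \<and> card (A j) \<le> d) \<and> (\<forall>q\<in>Q. w q \<le> card {j \<in> {..<n}. q \<in> A j})"
proof -
  obtain u where u: "\<And>q. q \<in> Q \<Longrightarrow>
      \<exists>s. s + w q \<le> sum w Q \<and> (\<forall>k\<in>{s..<s + w q}. u k = q)"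
    using consecutive_blocks[OF assms(1), of w] by blast
  define A where "A j = (\<lambda>i. u (i * n + j)) ` {..<d}" for j
  have "w q \<le> card {j \<in> {..<n}. q \<in> A j}" if q: "q \<in> Q" for q
  proof (cases "n = 0")
    case True
    then show ?thesis using assms(2)[OF q] by simp
  next
    case False
    obtain s where s: "s + w q \<le> sum w Q" "\<And>k. k \<in> {s..<s + w q} \<Longrightarrow> u k = q"
      using u[OF q] by blast
    have inj: "inj_on (\<lambda>k. k mod n) {s..<s + w q}"
    proof (rule linorder_inj_onI)
      fix k l assume "k < l" "k \<in> {s..<s + w q}" "l \<in> {s..<s + w q}"
      then have "0 < l - k" "l - k < n" using assms(2)[OF q] by auto
      then show "k mod n \<noteq> l mod n"
        using \<open>k < l\<close> mod_eq_dvd_iff_nat[of k l n] by (auto dest: nat_dvd_not_less)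
    qed auto
    have "(\<lambda>k. k mod n) ` {s..<s + w q} \<subseteq> {j \<in> {..<n}. q \<in> A j}"
    proof (intro image_subsetI CollectI conjI)
      fix k assume k: "k \<in> {s..<s + w q}"
      then have "k < n * d" using s(1) assms(3) by auto
      then have "k div n < d" by (simp add: less_mult_imp_div_less mult.commute)
      moreover have "u (k div n * n + k mod n) = q" using s(2)[OF k] by simp
      ultimately show "q \<in> A (k mod n)" unfolding A_def by (intro image_eqI) auto
    qed (use False in auto)
    then have "card ((\<lambda>k. k mod n) ` {s..<s + w q}) \<le> card {j \<in> {..<n}. q \<in> A j}"
      by (intro card_mono) auto
    then show ?thesis by (simp add: card_image[OF inj])
  qed
  moreover have "finite (A j) \<and> card (A j) \<le> d" for j
    unfolding A_def using card_image_le[of "{..<d}"] by auto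
  ultimately show ?thesis by blast
qed

lemma hyperplane_through_few_points:
  fixes S :: "'a::euclidean_space set"
  assumes "finite S" and "card S \<le> DIM('a)"
  shows "\<exists>a b. a \<noteq> 0 \<and> (\<forall>x\<in>S. a \<bullet> x = b)"
proof -
  have "aff_dim S < DIM('a)"
    using aff_dim_le_card[OF assms(1)] assms(2) by linarith
  then show ?thesis
    using aff_lowdim_subset_hyperplane[of S] by (metis (mono_tags) mem_Collect_eq subsetD)
qed

section \<open>Singularity\<close>

text \<open>
  The sum has at least two positive terms, so each term is smaller than the left-hand side, and the
  binomial coefficients increase with their upper argument.
\<close>

lemma order_less_degree_if_dimensions_match:
  fixes p :: "'a \<Rightarrow> nat"
  assumes "finite Q" and "card Q \<ge> 2" and "(n + d) choose d = (\<Sum>q\<in>Q. (p q + d) choose d)"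
    and "q \<in> Q"
  shows "p q < n"
proof (rule ccontr)
  assume "\<not> p q < n"
  then have "(n + d) choose d \<le> (p q + d) choose d" by (intro binomial_right_mono) simp
  moreover have "card (Q - {q}) > 0" using assms(1,2,4) by simp
  then have "Q - {q} \<noteq> {}" by force
  then have "0 < (\<Sum>r\<in>Q - {q}. (p r + d) choose d)"
    using assms(1) by (intro sum_pos) auto
  ultimately show False
    using assms(3) sum.remove[OF assms(1,4), of "\<lambda>q. (p q + d) choose d"] by linarith
qed

theorem theorem5:
  fixes X :: "nat \<Rightarrow> real^'d" and p :: "nat \<Rightarrow> nat" and n m :: nat
  assumes "CARD('d) \<ge> 2" and "m \<ge> 2"
    and "inj_on X {1..m}"
    and "(n + CARD('d)) choose CARD('d) = (\<Sum>q=1..m. (p q + CARD('d)) choose CARD('d))"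
    and "(\<Sum>q=1..m. p q) + m \<le> n * CARD('d)"
  shows "hermite_singular n m p X"
proof -
  have "Suc (p q) \<le> n" if "q \<in> {1..m}" for q
    using order_less_degree_if_dimensions_match[OF _ _ assms(4) that] assms(2) by auto
  moreover have "(\<Sum>q=1..m. Suc (p q)) \<le> n * CARD('d)"
    using assms(5) by (simp add: sum_Suc)
  ultimately have "\<exists>A. (\<forall>j. finite (A j) \<and> card (A j) \<le> CARD('d)) \<and>
      (\<forall>q\<in>{1..m}. Suc (p q) \<le> card {j \<in> {..<n}. q \<in> A j})"
    by (intro round_robin_distribution) simp_all
  then obtain A where A: "\<And>j. finite (A j)" "\<And>j. card (A j) \<le> CARD('d)"
    "\<And>q. q \<in> {1..m} \<Longrightarrow> Suc (p q) \<le> card {j \<in> {..<n}. q \<in> A j}"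
    by blast
  have "\<exists>a b. a \<noteq> 0 \<and> (\<forall>x\<in>X ` A j. a \<bullet> x = b)" for j
  proof (rule hyperplane_through_few_points)
    show "card (X ` A j) \<le> DIM(real^'d)"
      using card_image_le[OF A(1), of X j] A(2)[of j] by simp
  qed (simp add: A(1))
  then have "\<forall>j. \<exists>a b. a \<noteq> 0 \<and> (\<forall>q\<in>A j. a \<bullet> X q = b)" by simp
  then obtain v b where v: "\<And>j. v j \<noteq> 0" and vb: "\<And>j q. q \<in> A j \<Longrightarrow> v j \<bullet> X q = b j"
    by metis
  have L: "real_polynomial_function (\<lambda>x. v j \<bullet> x - b j)" for j
    by (intro real_polynomial_function_diff real_polynomial_function.intros(2)
        real_polynomial_function.intros(1)[OF bounded_linear_inner_right])
  define F where "F = (\<lambda>x. \<Prod>j<n. v j \<bullet> x - b j)"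
  have "vanishing_order (Suc (p q)) (X q) F" if "q \<in> {1..m}" for q
  proof (rule vanishing_order_antimono)
    show "vanishing_order (card {j \<in> {..<n}. v j \<bullet> X q - b j = 0}) (X q) F"
      unfolding F_def using L by (rule vanishing_order_prod[OF finite_lessThan])
    have "card {j \<in> {..<n}. q \<in> A j} \<le> card {j \<in> {..<n}. v j \<bullet> X q - b j = 0}"
      by (intro card_mono) (auto simp: vb)
    then show "Suc (p q) \<le> card {j \<in> {..<n}. v j \<bullet> X q - b j = 0}"
      using A(3)[OF that] by linarith
  qed
  then have "mixed_partial \<alpha> F (X q) = 0" if "q \<in> {1..m}" "mi_size \<alpha> \<le> p q" for q \<alpha>
    using that by (intro mixed_partial_eq_0[of "Suc (p q)"]) auto
  moreover have "F \<in> poly_space n"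
    unfolding F_def by (rule prod_affine_in_poly_space)
  ultimately have "hermite_solution n m p X (\<lambda>_ _. 0) F"
    unfolding hermite_solution_def by blast
  moreover have "hermite_solution n m p X (\<lambda>_ _. 0) (\<lambda>_. 0)"
    unfolding hermite_solution_def
    by (auto intro: poly_space_zero mixed_partial_eq_0[OF vanishing_order_zero lessI])
  moreover have "F \<noteq> (\<lambda>_. 0)"
  proof -
    obtain x where "F x \<noteq> 0"
      unfolding F_def using prod_affine_nonzero[of "{..<n}" v b] v by blast
    then show ?thesis by auto
  qed
  ultimately have "\<not> (\<exists>!f. hermite_solution n m p X (\<lambda>_ _. 0) f)" by metis
  then show ?thesis
    unfolding hermite_singular_def hermite_regular_def by (auto intro!: exI[of _ "\<lambda>_ _. 0"])
qed

end
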